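(* Let $n\geq 2$ and $m\geq 1$ be integers, let $w$ be a complex polynomial in one variable of degree $m$, and let $\Gamma_1,\dots,\Gamma_n\in\mathbb R\setminus\{0\}$ satisfy $$\sum_{j\in I}\Gamma_j\neq 0\ \text{ for every nonempty } I\subset\{1,\dots,n\},\qquad\text{and}\qquad \sum_{1\le i<j\le n}\Gamma_i\Gamma_j\neq 0 .$$ Let $i_0$ be the number of distinct values among $\Gamma_1,\dots,\Gamma_n$, and let $n_1,\dots,n_{i_0}$ (with $\sum_i n_i=n$) be the numbers of indices $j$ at which each of these distinct values is taken. Then there are at most $$\frac{(m+n-1)!}{(m-1)!\,n_1!\cdots n_{i_0}!}$$ fixed equilibrium configurations for the circulations $\Gamma_1,\dots,\Gamma_n$ and the background flow $w$. Moreover, this bound can be attained, i.e. there exist integers $n\geq 2$ and $m\geq 1$, a complex polynomial $w$ in one variable of degree $m$, and $\Gamma_1,\dots,\Gamma_n\in\mathbb R\setminus\{0\}$ satisfying $\sum_{j\in I}\Gamma_j\neq 0$ for every nonempty $I\subset\{1,\dots,n\}$ and $\sum_{1\le i<j\le n}\Gamma_i\Gamma_j\neq 0$, for which the number of fixed equilibrium configurations equals $\frac{(m+n-1)!}{(m-1)!\,n_1!\cdots n_{i_0}!}$, where $i_0$ is the number of distinct values among $\Gamma_1,\dots,\Gamma_n$ and $n_1,\dots,n_{i_0}$ are the numbers of indices $j$ at which each of these distinct values is taken.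
   Context: Fix the polynomial $w$ (complex velocity of the background flow) and the circulations $\Gamma_1,\dots,\Gamma_n$. Consider the solutions $\mathbf z=(z_1,\dots,z_n)\in\mathbb C^n$ (necessarily with $z_i\neq z_j$ for $i\neq j$) of the system $$-w(z_j)=\frac{1}{2\pi \mathrm i}\sum_{\substack{k=1\\k\neq j}}^n\frac{\Gamma_k}{z_j-z_k},\qquad j=1,\dots,n .$$ For such a solution $\mathbf z$, define the rational function $$V_{\mathbf z}(\zeta):=\frac{1}{2\pi \mathrm i}\sum_{j=1}^n\frac{\Gamma_j}{\zeta-z_j}+w(\zeta),\qquad \zeta\in\mathbb C\setminus\{z_1,\dots,z_n\}.$$ Two solutions $\mathbf z,\mathbf z'$ are equivalent, $\mathbf z\sim\mathbf z'$, if there exists $(a,b)\in(\mathbb C\setminus\{0\})\times\mathbb C$ such that $$a\,V_{\mathbf z'}(a\zeta+b)=V_{\mathbf z}(\zeta)\quad\text{for }\zeta\in\mathbb C\setminus\{z_1,\dots,z_n\}$$ (equality of rational functions of $\zeta$). A fixed equilibrium configuration is an equivalence class $[\mathbf z]$ of solutions under $\sim$. *)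

theory Defs
  imports Complex_Main "HOL-Library.FuncSet" "HOL-Computational_Algebra.Polynomial"
begin

text \<open>
  Solutions are functions on the index set \<open>{1..n}\<close> (extensional, so that each point of
  \<open>\<complex>\<^sup>n\<close> is represented exactly once).  The polynomial \<open>w\<close> is the complex velocity of
  the background flow and \<open>\<Gamma>\<close> gives the circulations; only \<open>\<Gamma> 1, \<dots>, \<Gamma> n\<close> matter.
\<close>

definition equilibria :: "nat \<Rightarrow> (nat \<Rightarrow> real) \<Rightarrow> complex poly \<Rightarrow> (nat \<Rightarrow> complex) set" where
  "equilibria n \<Gamma> w =
    {z \<in> {1..n} \<rightarrow>\<^sub>E UNIV. inj_on z {1..n} \<and>
       (\<forall>j\<in>{1..n}. - poly w (z j) =
          1 / (2 * complex_of_real pi * \<i>) *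
          (\<Sum>k\<in>{1..n} - {j}. complex_of_real (\<Gamma> k) / (z j - z k)))}"

definition velocity ::
  "nat \<Rightarrow> (nat \<Rightarrow> real) \<Rightarrow> complex poly \<Rightarrow> (nat \<Rightarrow> complex) \<Rightarrow> complex \<Rightarrow> complex" where
  "velocity n \<Gamma> w z \<zeta> =
     1 / (2 * complex_of_real pi * \<i>) * (\<Sum>j\<in>{1..n}. complex_of_real (\<Gamma> j) / (\<zeta> - z j))
     + poly w \<zeta>"

text \<open>
  Since \<open>x / 0 = 0\<close>, \<open>velocity\<close> has meaningless values at the poles \<open>z j\<close>.  The equality
  of rational functions is therefore required at every \<open>\<zeta>\<close> that is no pole of the right-hand
  side, and includes that such a \<open>\<zeta>\<close> is no pole of the left-hand side either.
\<close>

definition config_rel ::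
  "nat \<Rightarrow> (nat \<Rightarrow> real) \<Rightarrow> complex poly \<Rightarrow> ((nat \<Rightarrow> complex) \<times> (nat \<Rightarrow> complex)) set" where
  "config_rel n \<Gamma> w =
    {(z, z'). z \<in> equilibria n \<Gamma> w \<and> z' \<in> equilibria n \<Gamma> w \<and>
       (\<exists>a b. a \<noteq> 0 \<and>
          (\<forall>\<zeta>. \<zeta> \<notin> z ` {1..n} \<longrightarrow>
             a * \<zeta> + b \<notin> z' ` {1..n} \<and>
             a * velocity n \<Gamma> w z' (a * \<zeta> + b) = velocity n \<Gamma> w z \<zeta>))}"

definition fixed_configurations ::
  "nat \<Rightarrow> (nat \<Rightarrow> real) \<Rightarrow> complex poly \<Rightarrow> (nat \<Rightarrow> complex) set set" where
  "fixed_configurations n \<Gamma> w = equilibria n \<Gamma> w // config_rel n \<Gamma> w"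

definition admissible :: "nat \<Rightarrow> nat \<Rightarrow> (nat \<Rightarrow> real) \<Rightarrow> complex poly \<Rightarrow> bool" where
  "admissible n m \<Gamma> w \<longleftrightarrow>
     n \<ge> 2 \<and> m \<ge> 1 \<and> degree w = m \<and>
     (\<forall>j\<in>{1..n}. \<Gamma> j \<noteq> 0) \<and>
     (\<forall>I. I \<noteq> {} \<and> I \<subseteq> {1..n} \<longrightarrow> (\<Sum>j\<in>I. \<Gamma> j) \<noteq> 0) \<and>
     (\<Sum>j\<in>{1..n}. \<Sum>i\<in>{1..<j}. \<Gamma> i * \<Gamma> j) \<noteq> 0"

text \<open>The product runs over the distinct values \<open>c\<close> of the circulations.\<close>

definition config_bound :: "nat \<Rightarrow> nat \<Rightarrow> (nat \<Rightarrow> real) \<Rightarrow> real" where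
  "config_bound n m \<Gamma> =
     fact (m + n - 1) /
     (fact (m - 1) * (\<Prod>c\<in>\<Gamma> ` {1..n}. fact (card {j \<in> {1..n}. \<Gamma> j = c})))"

lemma equiv_config_rel: "equiv (equilibria n \<Gamma> w) (config_rel n \<Gamma> w)"
proof (rule equivI)
  show "config_rel n \<Gamma> w \<subseteq> equilibria n \<Gamma> w \<times> equilibria n \<Gamma> w"
    by (auto simp: config_rel_def)
  show "refl_on (equilibria n \<Gamma> w) (config_rel n \<Gamma> w)"
  proof (rule refl_onI)
    fix z assume z: "z \<in> equilibria n \<Gamma> w"
    have "\<exists>a b. a \<noteq> 0 \<and> (\<forall>\<zeta>. \<zeta> \<notin> z ` {1..n} \<longrightarrow> a * \<zeta> + b \<notin> z ` {1..n} \<and>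
             a * velocity n \<Gamma> w z (a * \<zeta> + b) = velocity n \<Gamma> w z \<zeta>)"
      by (rule exI[of _ 1], rule exI[of _ 0]) simp
    then show "(z, z) \<in> config_rel n \<Gamma> w"
      using z unfolding config_rel_def by blast
  qed
  show "sym (config_rel n \<Gamma> w)"
  proof (rule symI)
    fix z z' assume "(z, z') \<in> config_rel n \<Gamma> w"
    then obtain a b where z: "z \<in> equilibria n \<Gamma> w" and z': "z' \<in> equilibria n \<Gamma> w"
      and a: "a \<noteq> 0"
      and h: "\<And>\<zeta>. \<zeta> \<notin> z ` {1..n} \<Longrightarrow> a * \<zeta> + b \<notin> z' ` {1..n} \<and>
             a * velocity n \<Gamma> w z' (a * \<zeta> + b) = velocity n \<Gamma> w z \<zeta>"
      unfolding config_rel_def by auto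
    let ?f = "\<lambda>\<zeta>. a * \<zeta> + b"
    have inj: "inj ?f" using a by (auto simp: inj_on_def)
    have sub: "z' ` {1..n} \<subseteq> ?f ` (z ` {1..n})"
    proof
      fix y assume y: "y \<in> z' ` {1..n}"
      have e: "?f ((y - b) / a) = y" using a by simp
      have "(y - b) / a \<in> z ` {1..n}" using h[of "(y - b) / a"] e y by auto
      then show "y \<in> ?f ` (z ` {1..n})" using e by (metis image_eqI)
    qed
    have "card (z' ` {1..n}) = card (z ` {1..n})"
      using z z' by (simp add: equilibria_def card_image)
    also have "\<dots> = card (?f ` (z ` {1..n}))"
      using inj by (metis card_image inj_on_subset subset_UNIV)
    finally have eq: "z' ` {1..n} = ?f ` (z ` {1..n})"
      using sub by (intro card_subset_eq) auto
    have "\<forall>\<zeta>. \<zeta> \<notin> z' ` {1..n} \<longrightarrow> (1/a) * \<zeta> + (- b/a) \<notin> z ` {1..n} \<and>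
             (1/a) * velocity n \<Gamma> w z ((1/a) * \<zeta> + (- b/a)) = velocity n \<Gamma> w z' \<zeta>"
    proof (intro allI impI)
      fix \<zeta> assume nz: "\<zeta> \<notin> z' ` {1..n}"
      define x where "x = (1/a) * \<zeta> + (- b/a)"
      have fx: "?f x = \<zeta>" using a by (simp add: x_def field_simps)
      then have x: "x \<notin> z ` {1..n}" using nz eq by (metis image_eqI)
      then have "(1/a) * velocity n \<Gamma> w z x = velocity n \<Gamma> w z' \<zeta>"
        using h[OF x] fx a by (metis divide_inverse mult.commute mult.left_neutral nonzero_mult_div_cancel_left)
      then show "(1/a) * \<zeta> + (- b/a) \<notin> z ` {1..n} \<and>
             (1/a) * velocity n \<Gamma> w z ((1/a) * \<zeta> + (- b/a)) = velocity n \<Gamma> w z' \<zeta>"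
        using x by (simp only: x_def) simp
    qed
    then have "\<exists>a b. a \<noteq> 0 \<and> (\<forall>\<zeta>. \<zeta> \<notin> z' ` {1..n} \<longrightarrow> a * \<zeta> + b \<notin> z ` {1..n} \<and>
             a * velocity n \<Gamma> w z (a * \<zeta> + b) = velocity n \<Gamma> w z' \<zeta>)"
      using a by (metis divide_eq_0_iff zero_neq_one)
    then show "(z', z) \<in> config_rel n \<Gamma> w"
      using z z' unfolding config_rel_def by blast
  qed
  show "trans (config_rel n \<Gamma> w)"
  proof (rule transI)
    fix x y z assume "(x, y) \<in> config_rel n \<Gamma> w" "(y, z) \<in> config_rel n \<Gamma> w"
    then obtain a b c d where m: "x \<in> equilibria n \<Gamma> w" "z \<in> equilibria n \<Gamma> w"
      and nz: "a \<noteq> 0" "c \<noteq> 0"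
      and h: "\<And>\<zeta>. \<zeta> \<notin> x ` {1..n} \<Longrightarrow> a * \<zeta> + b \<notin> y ` {1..n} \<and>
             a * velocity n \<Gamma> w y (a * \<zeta> + b) = velocity n \<Gamma> w x \<zeta>"
      and k: "\<And>\<zeta>. \<zeta> \<notin> y ` {1..n} \<Longrightarrow> c * \<zeta> + d \<notin> z ` {1..n} \<and>
             c * velocity n \<Gamma> w z (c * \<zeta> + d) = velocity n \<Gamma> w y \<zeta>"
      unfolding config_rel_def by auto
    have "\<forall>\<zeta>. \<zeta> \<notin> x ` {1..n} \<longrightarrow> (c * a) * \<zeta> + (c * b + d) \<notin> z ` {1..n} \<and>
             (c * a) * velocity n \<Gamma> w z ((c * a) * \<zeta> + (c * b + d)) = velocity n \<Gamma> w x \<zeta>"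
    proof (intro allI impI)
      fix \<zeta> assume "\<zeta> \<notin> x ` {1..n}"
      note h' = h[OF this]
      have e: "c * (a * \<zeta> + b) + d = (c * a) * \<zeta> + (c * b + d)" by (simp add: algebra_simps)
      show "(c * a) * \<zeta> + (c * b + d) \<notin> z ` {1..n} \<and>
             (c * a) * velocity n \<Gamma> w z ((c * a) * \<zeta> + (c * b + d)) = velocity n \<Gamma> w x \<zeta>"
        using k[OF conjunct1[OF h']] h' unfolding e by (metis mult.assoc mult.commute)
    qed
    then have "\<exists>a b. a \<noteq> 0 \<and> (\<forall>\<zeta>. \<zeta> \<notin> x ` {1..n} \<longrightarrow> a * \<zeta> + b \<notin> z ` {1..n} \<and>
             a * velocity n \<Gamma> w z (a * \<zeta> + b) = velocity n \<Gamma> w x \<zeta>)"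
      using nz by (metis mult_eq_0_iff)
    then show "(x, z) \<in> config_rel n \<Gamma> w"
      using m unfolding config_rel_def by blast
  qed
qed

end

theory Submission
  imports Defs "HOL-Library.Function_Algebras" "HOL-Combinatorics.Permutations"
begin

text \<open>
  Weighting the \<open>j\<close>-th equation by \<open>\<Gamma> j * z j ^ e\<close> and summing over \<open>j\<close> cancels the
  denominators, so for \<open>e = 0, \<dots>, n - 1\<close> the weighted power sum \<open>\<Sum>j. \<Gamma> j * z j ^ (m + e)\<close> equals a
  polynomial of lower degree on the set of solutions. Hence the number of solutions is at most
  the dimension \<open>D n m\<close> of the polynomial ring modulo these \<open>n\<close> power sums. Bezout's theorem is
  avoided: Newton's recurrence expresses \<open>\<Prod>i. z i\<close> times the power sum of exponent \<open>m\<close> by those of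
  exponents \<open>m + 1, \<dots>, m + n\<close>, whence \<open>D n (m + 1) \<le> D n m + n * D (n - 1) (m + 1)\<close>, and
  \<open>D n 0 = 0\<close> because the total circulation does not vanish. This gives
  \<open>D n m \<le> m * (m + 1) * \<dots> * (m + n - 1)\<close>. Relabelling vortices of equal circulation acts freely
  on the solutions and preserves every configuration, which accounts for the factorials in the
  denominator.
\<close>

section \<open>Polynomial functions\<close>

definition cst :: "complex \<Rightarrow> 'a \<Rightarrow> complex" where
  "cst c = (\<lambda>_. c)"

definition coord :: "'i \<Rightarrow> ('i \<Rightarrow> complex) \<Rightarrow> complex" where
  "coord i = (\<lambda>z. z i)"

lemma cst_apply: "cst c z = c"
  by (simp add: cst_def)

lemma coord_apply: "coord i z = z i"
  by (simp add: coord_def)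

lemma power_fun_apply: "(f ^ k) z = f z ^ k" for f :: "'a \<Rightarrow> complex"
  by (induction k) auto

lemma uminus_fun_apply: "(- f) z = - f z" for f :: "'a \<Rightarrow> complex"
  by (simp add: fun_Compl_def)

lemma minus_fun_apply: "(f - g) z = f z - g z" for f :: "'a \<Rightarrow> complex"
  by (simp add: fun_diff_def)

lemma sum_fun_apply: "(\<Sum>i\<in>I. f i) z = (\<Sum>i\<in>I. f i z)" for f :: "'i \<Rightarrow> 'a \<Rightarrow> complex"
  by (induction I rule: infinite_finite_induct) auto

lemma prod_fun_apply: "(\<Prod>i\<in>I. f i) z = (\<Prod>i\<in>I. f i z)" for f :: "'i \<Rightarrow> 'a \<Rightarrow> complex"
  by (induction I rule: infinite_finite_induct) auto

text \<open>
  As simplification rules the evaluation equations also rewrite unapplied functions once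
  unification has eta-expanded them.
\<close>

declare zero_fun_apply [simp del] one_fun_apply [simp del] plus_fun_apply [simp del]
  times_fun_apply [simp del]

lemmas fun_apply = zero_fun_apply one_fun_apply plus_fun_apply times_fun_apply uminus_fun_apply
  minus_fun_apply power_fun_apply sum_fun_apply prod_fun_apply cst_apply coord_apply

text \<open>Scalars act through multiplication by a constant function, so linear combinations and
  ideal operations are computed in the same pointwise ring.\<close>

interpretation cfun: vector_space "\<lambda>c f. cst c * f :: 'a \<Rightarrow> complex"
  by standard (auto simp: fun_apply fun_eq_iff algebra_simps)

lemma span_mult_image:
  "b \<in> cfun.span B \<Longrightarrow> a * b \<in> cfun.span ((*) a ` B)"
proof (induction rule: cfun.span_induct_alt)
  case base
  show ?case using cfun.span_zero by simp
next
  case (step c x y)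
  have "a * (cst c * x + y) = cst c * (a * x) + a * y"
    by (simp add: algebra_simps)
  moreover have "a * x \<in> cfun.span ((*) a ` B)"
    using step by (auto intro: cfun.span_base)
  ultimately show ?case
    using step by (auto intro!: cfun.span_add cfun.span_scale)
qed

text \<open>
  \<open>polyfun J R\<close> contains the polynomial functions in the coordinates from \<open>J\<close> of degree strictly
  below \<open>R\<close>; the strict bound makes truncated subtraction of degrees harmless, since
  \<open>polyfun J 0\<close> is the zero space.
\<close>

inductive polyfun :: "'i set \<Rightarrow> nat \<Rightarrow> (('i \<Rightarrow> complex) \<Rightarrow> complex) \<Rightarrow> bool" for J where
  polyfun_zero: "polyfun J R 0"
| polyfun_cst: "polyfun J (Suc R) (cst c)"
| polyfun_coord_mult: "i \<in> J \<Longrightarrow> polyfun J R p \<Longrightarrow> polyfun J (Suc R) (coord i * p)"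
| polyfun_add: "polyfun J R p \<Longrightarrow> polyfun J R q \<Longrightarrow> polyfun J R (p + q)"

lemma polyfun_mono: "polyfun J R p \<Longrightarrow> R \<le> R' \<Longrightarrow> polyfun J R' p"
proof (induction arbitrary: R' rule: polyfun.induct)
  case (polyfun_cst R c)
  then show ?case by (cases R') (auto intro: polyfun.intros)
next
  case (polyfun_coord_mult i R p)
  then show ?case by (cases R') (auto intro: polyfun.intros)
qed (auto intro: polyfun.intros)

lemma polyfun_subset: "polyfun J R p \<Longrightarrow> J \<subseteq> K \<Longrightarrow> polyfun K R p"
  by (induction rule: polyfun.induct) (auto intro: polyfun.intros)

lemma polyfun_0_iff: "polyfun J 0 p \<longleftrightarrow> p = 0"
proof
  show "polyfun J 0 p \<Longrightarrow> p = 0"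
    by (induction "0::nat" p rule: polyfun.induct) auto
qed (auto intro: polyfun_zero)

lemma polyfun_empty: "polyfun {} R p \<Longrightarrow> \<exists>c. p = cst c"
proof (induction rule: polyfun.induct)
  case (polyfun_zero R)
  show ?case by (rule exI[of _ 0]) (auto simp: fun_apply fun_eq_iff)
next
  case (polyfun_add R p q)
  then obtain c d where "p = cst c" "q = cst d" by blast
  then show ?case by (intro exI[of _ "c + d"]) (auto simp: fun_apply fun_eq_iff)
qed auto

lemma polyfun_cmult: "polyfun J R p \<Longrightarrow> polyfun J R (cst c * p)"
proof (induction rule: polyfun.induct)
  case (polyfun_cst R d)
  have "cst c * cst d = (cst (c * d) :: ('a \<Rightarrow> complex) \<Rightarrow> complex)"
    by (auto simp: fun_apply fun_eq_iff)
  then show ?case by (simp add: polyfun.polyfun_cst)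
next
  case (polyfun_coord_mult i R p)
  then have "polyfun J (Suc R) (coord i * (cst c * p))"
    by (intro polyfun.polyfun_coord_mult)
  then show ?case by (simp add: mult.left_commute)
qed (auto intro: polyfun.intros simp: distrib_left)

lemma polyfun_uminus: "polyfun J R p \<Longrightarrow> polyfun J R (- p)"
  using polyfun_cmult[of J R p "- 1"] by (simp add: fun_apply fun_eq_iff)

text \<open>Because bounds are strict, \<open>Suc d\<close> means degree at most d. Thus a factor of
  degree below R times one of degree at most d has degree below R + d, also when R = 0.\<close>

lemma polyfun_mult:
  "polyfun J R p \<Longrightarrow> polyfun J (Suc d) q \<Longrightarrow> polyfun J (R + d) (p * q)"
proof (induction rule: polyfun.induct)
  case (polyfun_cst R c)
  then show ?case by (intro polyfun_mono[OF polyfun_cmult]) auto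
next
  case (polyfun_coord_mult i R p)
  then show ?case by (auto simp: mult.assoc intro: polyfun.polyfun_coord_mult)
qed (auto intro: polyfun.intros simp: distrib_right)

lemma polyfun_one: "polyfun J (Suc R) 1"
  using polyfun_cst[of J R 1] by (simp add: cst_def one_fun_def)

lemma polyfun_coord: "i \<in> J \<Longrightarrow> polyfun J (Suc (Suc 0)) (coord i)"
  using polyfun_coord_mult[OF _ polyfun_one, of i J 0] by simp

lemma polyfun_coord_power: "i \<in> J \<Longrightarrow> polyfun J (Suc k) (coord i ^ k)"
  by (induction k) (auto intro: polyfun_one polyfun_coord_mult)

lemma polyfun_sum:
  "(\<And>i. i \<in> I \<Longrightarrow> polyfun J R (f i)) \<Longrightarrow> polyfun J R (\<Sum>i\<in>I. f i)"
  by (induction I rule: infinite_finite_induct) (auto intro: polyfun.intros)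

lemma polyfun_prod_coord: "finite K \<Longrightarrow> K \<subseteq> J \<Longrightarrow> polyfun J (Suc (card K)) (\<Prod>i\<in>K. coord i)"
  by (induction K rule: finite_induct) (auto intro: polyfun_one polyfun_coord_mult)

text \<open>This is division with remainder by the coordinate \<open>coord i\<close>: the remainder
  is free of it, and the quotient loses one degree.\<close>

lemma polyfun_split:
  "polyfun J R p \<Longrightarrow> i \<in> J \<Longrightarrow>
    \<exists>p0 q. polyfun (J - {i}) R p0 \<and> polyfun J (R - 1) q \<and> p = p0 + coord i * q"
proof (induction rule: polyfun.induct)
  case (polyfun_zero R)
  show ?case by (intro exI[of _ 0]) (auto intro: polyfun.intros)
next
  case (polyfun_cst R c)
  show ?case by (intro exI[of _ "cst c"] exI[of _ 0]) (auto intro: polyfun.intros)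
next
  case (polyfun_coord_mult k R p)
  then obtain p0 q where pq: "polyfun (J - {i}) R p0" "polyfun J (R - 1) q" "p = p0 + coord i * q"
    by blast
  show ?case
  proof (cases "k = i")
    case True
    with polyfun_coord_mult show ?thesis
      by (intro exI[of _ 0] exI[of _ p]) (auto intro: polyfun.intros)
  next
    case False
    have "polyfun J R (coord k * q)"
      using pq(2) polyfun_coord_mult.hyps(1)
      by (cases R) (auto simp: polyfun_0_iff intro: polyfun.intros)
    moreover have "polyfun (J - {i}) (Suc R) (coord k * p0)"
      using False polyfun_coord_mult.hyps(1) pq(1) by (auto intro: polyfun.intros)
    ultimately show ?thesis
      using pq(3) by (intro exI[of _ "coord k * p0"] exI[of _ "coord k * q"]) (auto simp: algebra_simps)
  qed
next
  case (polyfun_add R p q)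
  then obtain p0 p1 q0 q1 where
    "polyfun (J - {i}) R p0" "polyfun J (R - 1) p1" "p = p0 + coord i * p1"
    "polyfun (J - {i}) R q0" "polyfun J (R - 1) q1" "q = q0 + coord i * q1"
    by blast
  then show ?case
    by (intro exI[of _ "p0 + q0"] exI[of _ "p1 + q1"]) (auto simp: algebra_simps intro: polyfun.intros)
qed

section \<open>Ideals generated by weighted power sums\<close>

definition psum :: "'i set \<Rightarrow> ('i \<Rightarrow> complex) \<Rightarrow> nat \<Rightarrow> ('i \<Rightarrow> complex) \<Rightarrow> complex" where
  "psum J \<Gamma> l = (\<Sum>j\<in>J. cst (\<Gamma> j) * coord j ^ l)"

text \<open>
  The degree bound is imposed on every summand of the representation, not only on the resulting
  polynomial; this is what later allows replacing the forms \<open>psum\<close> by inhomogeneous polynomials.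
\<close>

inductive psum_ideal ::
  "'i set \<Rightarrow> ('i \<Rightarrow> complex) \<Rightarrow> nat set \<Rightarrow> nat \<Rightarrow> (('i \<Rightarrow> complex) \<Rightarrow> complex) \<Rightarrow> bool"
  for J \<Gamma> A where
  psum_ideal_zero: "psum_ideal J \<Gamma> A R 0"
| psum_ideal_gen:
    "l \<in> A \<Longrightarrow> polyfun J r h \<Longrightarrow> r + l \<le> R \<Longrightarrow> psum_ideal J \<Gamma> A R (h * psum J \<Gamma> l)"
| psum_ideal_add:
    "psum_ideal J \<Gamma> A R p \<Longrightarrow> psum_ideal J \<Gamma> A R q \<Longrightarrow> psum_ideal J \<Gamma> A R (p + q)"

lemma psum_ideal_subset:
  "psum_ideal J \<Gamma> A R t \<Longrightarrow> A \<subseteq> B \<Longrightarrow> psum_ideal J \<Gamma> B R t"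
  by (induction rule: psum_ideal.induct) (auto intro: psum_ideal.intros)

lemma psum_ideal_mult:
  assumes "psum_ideal J \<Gamma> A R t" "polyfun J (Suc d) a"
  shows "psum_ideal J \<Gamma> A (R + d) (a * t)"
  using assms(1)
proof (induction rule: psum_ideal.induct)
  case (psum_ideal_gen l r h R)
  have "polyfun J (r + d) (h * a)"
    using psum_ideal_gen.hyps(2) assms(2) by (rule polyfun_mult)
  then have "psum_ideal J \<Gamma> A (R + d) (h * a * psum J \<Gamma> l)"
    using psum_ideal_gen by (intro psum_ideal.psum_ideal_gen) auto
  then show ?case by (simp add: algebra_simps)
qed (auto intro: psum_ideal.intros simp: distrib_left)

lemma psum_ideal_sum:
  "(\<And>i. i \<in> I \<Longrightarrow> psum_ideal J \<Gamma> A R (f i)) \<Longrightarrow> psum_ideal J \<Gamma> A R (\<Sum>i\<in>I. f i)"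
  by (induction I rule: infinite_finite_induct) (auto intro: psum_ideal.intros)

lemma psum_ideal_remove:
  assumes "psum_ideal (J - {i}) \<Gamma> A R t" "i \<in> J" "finite J" "0 \<notin> A"
  shows "\<exists>q s. polyfun J (R - 1) q \<and> psum_ideal J \<Gamma> A R s \<and> t = s + coord i * q"
  using assms(1)
proof (induction rule: psum_ideal.induct)
  case (psum_ideal_zero R)
  show ?case by (intro exI[of _ 0]) (auto intro: polyfun.intros psum_ideal.intros)
next
  case (psum_ideal_gen l r h R)
  have h: "polyfun J r h"
    using psum_ideal_gen.hyps(2) by (rule polyfun_subset) auto
  have l: "coord i ^ l = coord i * coord i ^ (l - 1)" "l \<noteq> 0"
    using psum_ideal_gen.hyps(1) assms(4) by (cases l; auto)+
  have "psum J \<Gamma> l = cst (\<Gamma> i) * coord i ^ l + psum (J - {i}) \<Gamma> l"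
    unfolding psum_def using assms by (intro sum.remove)
  then have "h * psum (J - {i}) \<Gamma> l
      = h * psum J \<Gamma> l + coord i * (- (cst (\<Gamma> i) * (h * coord i ^ (l - 1))))"
    by (simp add: l(1) algebra_simps)
  moreover have "psum_ideal J \<Gamma> A R (h * psum J \<Gamma> l)"
    using psum_ideal_gen.hyps h by (intro psum_ideal.psum_ideal_gen)
  moreover have "polyfun J (r + (l - 1)) (h * coord i ^ (l - 1))"
    using h assms(2) by (intro polyfun_mult polyfun_coord_power)
  then have "polyfun J (R - 1) (- (cst (\<Gamma> i) * (h * coord i ^ (l - 1))))"
    using psum_ideal_gen.hyps(3) l(2)
    by (intro polyfun_uminus polyfun_cmult) (auto elim: polyfun_mono)
  ultimately show ?case by blast
next
  case (psum_ideal_add R t u)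
  then obtain q s q' s' where
    "polyfun J (R - 1) q" "psum_ideal J \<Gamma> A R s" "t = s + coord i * q"
    "polyfun J (R - 1) q'" "psum_ideal J \<Gamma> A R s'" "u = s' + coord i * q'"
    by blast
  then show ?case
    by (intro exI[of _ "q + q'"] exI[of _ "s + s'"])
      (auto simp: algebra_simps intro: polyfun.intros psum_ideal.intros)
qed

text \<open>The coefficients are elementary symmetric polynomials up to sign. Using z i - x instead
  of x - z i makes the constant coefficient the plain product of the coordinates.\<close>

lemma prod_coord_diff_expand:
  assumes "finite K" "K \<subseteq> J"
  shows "\<exists>c. (\<forall>k. polyfun J (Suc (card K - k)) (c k)) \<and>
    (\<forall>z x. (\<Prod>i\<in>K. z i - x) = (\<Sum>k\<le>card K. c k z * x ^ k))"
  using assms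
proof (induction K rule: finite_induct)
  case empty
  show ?case by (intro exI[of _ "\<lambda>_. 1"] conjI allI) (rule polyfun_one, simp add: fun_apply)
next
  case (insert i K)
  then obtain c where c: "\<And>k. polyfun J (Suc (card K - k)) (c k)"
    "\<And>z x. (\<Prod>i\<in>K. z i - x) = (\<Sum>k\<le>card K. c k z * x ^ k)"
    by auto
  define n where "n = card K"
  \<comment> \<open>These are the coefficients after multiplication by the new factor z i - x; the
    case distinctions cut off the indices outside 0..n.\<close>
  define d where "d k = (if k \<le> n then coord i * c k else 0) - (if k = 0 then 0 else c (k - 1))" for k
  have "polyfun J (Suc (Suc n - k)) (d k)" for k
  proof -
    have "polyfun J (Suc (Suc n - k)) (if k \<le> n then coord i * c k else 0)"
      using c(1)[of k] insert.prems by (auto simp: n_def Suc_diff_le intro: polyfun.intros)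
    moreover have "polyfun J (Suc (Suc n - k)) (if k = 0 then 0 else c (k - 1))"
      using c(1)[of "k - 1"] by (cases k) (auto simp: n_def intro: polyfun.intros)
    ultimately show ?thesis
      unfolding d_def diff_conv_add_uminus by (intro polyfun_add polyfun_uminus)
  qed
  moreover have "(\<Prod>j\<in>insert i K. z j - x) = (\<Sum>k\<le>Suc n. d k z * x ^ k)" for z x
  proof -
    have "d k z = (if k \<le> n then z i * c k z else 0) - (if k = 0 then 0 else c (k - 1) z)" for k
      by (simp add: d_def fun_apply)
    then have "(\<Sum>k\<le>Suc n. d k z * x ^ k)
        = (\<Sum>k\<le>Suc n. (if k \<le> n then z i * c k z else 0) * x ^ k)
          - (\<Sum>k\<le>Suc n. (if k = 0 then 0 else c (k - 1) z) * x ^ k)"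
      by (simp only: left_diff_distrib sum_subtractf)
    also have "(\<Sum>k\<le>Suc n. (if k \<le> n then z i * c k z else 0) * x ^ k) = z i * (\<Sum>k\<le>n. c k z * x ^ k)"
      by (simp add: sum_distrib_left mult.assoc)
    also have "(\<Sum>k\<le>Suc n. (if k = 0 then 0 else c (k - 1) z) * x ^ k) = x * (\<Sum>k\<le>n. c k z * x ^ k)"
      by (subst sum.atMost_Suc_shift) (simp add: sum_distrib_left algebra_simps)
    finally show ?thesis
      using insert.hyps c(2)[of z x] by (simp add: n_def left_diff_distrib)
  qed
  ultimately show ?case
    using insert.hyps by (intro exI[of _ d]) (auto simp: n_def)
qed

text \<open>
  Every \<open>z j\<close> is a root of \<open>\<Prod>i\<in>J. z i - X\<close>, which gives a linear recurrence for the weighted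
  power sums whose constant coefficient is \<open>\<Prod>i\<in>J. z i\<close>.
\<close>

lemma psum_ideal_shift:
  assumes "finite J" "card J = n" "psum_ideal J \<Gamma> {m..<m + n} R t"
  shows "psum_ideal J \<Gamma> {Suc m..<Suc m + n} (R + n) ((\<Prod>i\<in>J. coord i) * t)"
  using assms(3)
proof (induction rule: psum_ideal.induct)
  case (psum_ideal_gen l r h R)
  define e where "e = (\<Prod>i\<in>J. coord i)"
  have e: "polyfun J (Suc n) e"
    unfolding e_def using polyfun_prod_coord[of J J] assms by auto
  show ?case
  proof (cases "l = m")
    \<comment> \<open>A generator with l > m belongs to the shifted range already, so only the
      smallest exponent needs the recurrence.\<close>
    case False
    have "polyfun J (r + n) (h * e)"
      using psum_ideal_gen.hyps(2) e by (rule polyfun_mult)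
    then have "psum_ideal J \<Gamma> {Suc m..<Suc m + n} (R + n) ((h * e) * psum J \<Gamma> l)"
      using psum_ideal_gen.hyps False by (intro psum_ideal.psum_ideal_gen) auto
    then show ?thesis by (simp add: algebra_simps e_def)
  next
    case True
    obtain c where c: "\<And>k. polyfun J (Suc (n - k)) (c k)"
      "\<And>z x. (\<Prod>i\<in>J. z i - x) = (\<Sum>k\<le>n. c k z * x ^ k)"
      using prod_coord_diff_expand[of J J] assms by auto
    have c0: "c 0 = e"
    proof
      fix z
      show "c 0 z = e z"
        using c(2)[of z 0] by (simp add: fun_apply e_def power_0_left if_distrib cong: if_cong)
    qed
    have "(\<Sum>k\<le>n. c k * psum J \<Gamma> (m + k)) = 0"
    proof
      fix z
      have "(\<Sum>k\<le>n. c k * psum J \<Gamma> (m + k)) z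
          = (\<Sum>k\<le>n. \<Sum>j\<in>J. \<Gamma> j * z j ^ m * (c k z * z j ^ k))"
        by (simp add: fun_apply psum_def sum_distrib_left power_add algebra_simps)
      \<comment> \<open>After exchanging the sums, the inner one is the product evaluated at x = z
        j, where the factor i = j vanishes.\<close>
      also have "\<dots> = (\<Sum>j\<in>J. \<Gamma> j * z j ^ m * (\<Prod>i\<in>J. z i - z j))"
        by (subst sum.swap) (simp add: c(2) sum_distrib_left)
      also have "\<dots> = 0"
        using assms(1) by (intro sum.neutral) (auto simp: prod_zero_iff)
      finally show "(\<Sum>k\<le>n. c k * psum J \<Gamma> (m + k)) z = 0 z" by (simp add: fun_apply)
    qed
    moreover have "(\<Sum>k\<le>n. c k * psum J \<Gamma> (m + k))
        = c 0 * psum J \<Gamma> m + (\<Sum>k\<in>{1..n}. c k * psum J \<Gamma> (m + k))"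
      by (subst atMost_atLeast0, subst sum.atLeast_Suc_atMost) auto
    ultimately have "e * psum J \<Gamma> m = - (\<Sum>k\<in>{1..n}. c k * psum J \<Gamma> (m + k))"
      using c0 by (simp add: add_eq_0_iff2)
    then have "e * (h * psum J \<Gamma> m) = (\<Sum>k\<in>{1..n}. - (h * c k) * psum J \<Gamma> (m + k))"
      by (simp add: mult.left_commute[of e h] sum_distrib_left sum_negf algebra_simps)
    moreover have "psum_ideal J \<Gamma> {Suc m..<Suc m + n} (R + n)
        (\<Sum>k\<in>{1..n}. - (h * c k) * psum J \<Gamma> (m + k))"
    proof (intro psum_ideal_sum)
      fix k assume k: "k \<in> {1..n}"
      have "polyfun J (r + (n - k)) (- (h * c k))"
        using psum_ideal_gen.hyps(2) c(1) by (intro polyfun_uminus polyfun_mult)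
      then show "psum_ideal J \<Gamma> {Suc m..<Suc m + n} (R + n) (- (h * c k) * psum J \<Gamma> (m + k))"
        using psum_ideal_gen.hyps k True by (intro psum_ideal.psum_ideal_gen) auto
    qed
    ultimately show ?thesis using True by (simp add: e_def)
  qed
qed (auto intro: psum_ideal.intros simp: distrib_left)

section \<open>Spanning sets modulo the ideal of power sums\<close>

text \<open>The set B spans the polynomials modulo a and the power sums; d is the degree lost on
  dividing by a. Taking a = 0 leaves the quotient by the power sums alone. Bounding q and t makes it
  possible to reduce q again and to lower degrees in t later.\<close>

definition spans_mod ::
  "'i set \<Rightarrow> ('i \<Rightarrow> complex) \<Rightarrow> nat set \<Rightarrow> (('i \<Rightarrow> complex) \<Rightarrow> complex) \<Rightarrow> nat
    \<Rightarrow> (('i \<Rightarrow> complex) \<Rightarrow> complex) set \<Rightarrow> bool" where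
  "spans_mod J \<Gamma> A a d B \<longleftrightarrow>
    (\<forall>R p. polyfun J R p \<longrightarrow>
      (\<exists>b q t. b \<in> cfun.span B \<and> polyfun J (R - d) q \<and> psum_ideal J \<Gamma> A R t \<and> p = b + a * q + t))"

text \<open>First reduce modulo a, then reduce the resulting quotient modulo b: the second remainder
  reappears multiplied by a. Dimensions modulo a product are thus at most the sum of those modulo
  the factors.\<close>

lemma spans_mod_mult:
  assumes a: "spans_mod J \<Gamma> A a d B" "polyfun J (Suc d) a"
    and b: "spans_mod J \<Gamma> A b e C"
  shows "spans_mod J \<Gamma> A (a * b) (d + e) (B \<union> (*) a ` C)"
  unfolding spans_mod_def
proof (intro allI impI)
  fix R p assume "polyfun J R p"
  with a(1) obtain x q t where 1: "x \<in> cfun.span B" "polyfun J (R - d) q" "psum_ideal J \<Gamma> A R t"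
    "p = x + a * q + t"
    unfolding spans_mod_def by meson
  show "\<exists>x q t. x \<in> cfun.span (B \<union> (*) a ` C) \<and> polyfun J (R - (d + e)) q \<and>
      psum_ideal J \<Gamma> A R t \<and> p = x + a * b * q + t"
  proof (cases "d \<le> R")
    case False
    then have "q = 0" using 1(2) by (simp add: polyfun_0_iff)
    then show ?thesis
      using 1 cfun.span_mono[of B "B \<union> (*) a ` C"]
      by (intro exI[of _ x] exI[of _ 0] exI[of _ t]) (auto intro: polyfun.intros)
  next
    case True
    from b 1(2) obtain y q' t' where 2: "y \<in> cfun.span C" "polyfun J (R - d - e) q'"
      "psum_ideal J \<Gamma> A (R - d) t'" "q = y + b * q' + t'"
      unfolding spans_mod_def by meson
    have "x + a * y \<in> cfun.span (B \<union> (*) a ` C)"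
      using 1(1) span_mult_image[OF 2(1), of a] cfun.span_mono[of B "B \<union> (*) a ` C"]
        cfun.span_mono[of "(*) a ` C" "B \<union> (*) a ` C"]
      by (intro cfun.span_add) auto
    moreover have "psum_ideal J \<Gamma> A R (t + a * t')"
      using psum_ideal_mult[OF 2(3) a(2)] 1(3) True by (intro psum_ideal_add) auto
    ultimately show ?thesis
      using 1(4) 2(2,4)
      by (intro exI[of _ "x + a * y"] exI[of _ q'] exI[of _ "t + a * t'"])
        (auto simp: algebra_simps)
  qed
qed

lemma spans_mod_prod_coord:
  assumes "finite K" "K \<subseteq> J"
    and "\<And>i. i \<in> K \<Longrightarrow> \<exists>B. finite B \<and> card B \<le> D \<and> spans_mod J \<Gamma> A (coord i) 1 B"
  shows "\<exists>B. finite B \<and> card B \<le> card K * D \<and> spans_mod J \<Gamma> A (\<Prod>i\<in>K. coord i) (card K) B"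
  using assms
proof (induction K rule: finite_induct)
  case empty
  have "spans_mod J \<Gamma> A 1 0 {}"
    unfolding spans_mod_def
  proof (intro allI impI)
    fix R p assume "polyfun J R p"
    then show "\<exists>b q t. b \<in> cfun.span {} \<and> polyfun J (R - 0) q \<and> psum_ideal J \<Gamma> A R t \<and> p = b + 1 * q + t"
      by (intro exI[of _ 0] exI[of _ p]) (auto intro: psum_ideal.intros)
  qed
  then show ?case by (intro exI[of _ "{}"]) auto
next
  case (insert i K)
  then obtain B C where B: "finite B" "card B \<le> card K * D"
      "spans_mod J \<Gamma> A (\<Prod>i\<in>K. coord i) (card K) B"
    and C: "finite C" "card C \<le> D" "spans_mod J \<Gamma> A (coord i) 1 C"
    by (metis insertCI insert_subset)
  have "spans_mod J \<Gamma> A (coord i * (\<Prod>i\<in>K. coord i)) (1 + card K) (C \<union> (*) (coord i) ` B)"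
    using C(3) B(3) insert.prems by (intro spans_mod_mult) (auto intro: polyfun_coord)
  moreover have "card (C \<union> (*) (coord i) ` B) \<le> D + card K * D"
    using B(1,2) C(1,2) by (meson add_mono card_Un_le card_image_le le_trans)
  ultimately show ?case
    using insert.hyps B(1) C(1) by (intro exI[of _ "C \<union> (*) (coord i) ` B"]) auto
qed

text \<open>
  Modulo \<open>z i\<close> the remaining variables satisfy the same kind of equations, while dividing by
  \<open>\<Prod>i\<in>J. z i\<close> lowers \<open>m\<close>. With \<open>D n m = \<Prod>l<n. m + l\<close> this matches the recursion
  \<open>D n (m + 1) = D n m + n * D (n - 1) (m + 1)\<close>.
\<close>

lemma spans_mod_psum_ideal:
  fixes \<Gamma> :: "'i \<Rightarrow> complex"
  assumes "finite J" "card J = n" "\<And>I. I \<noteq> {} \<Longrightarrow> I \<subseteq> J \<Longrightarrow> (\<Sum>j\<in>I. \<Gamma> j) \<noteq> 0"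
  shows "\<exists>B. finite B \<and> card B \<le> (\<Prod>l<n. m + l) \<and> spans_mod J \<Gamma> {m..<m + n} 0 0 B"
  using assms
proof (induction n arbitrary: J m)
  case 0
  then have "J = {}" by simp
  have "spans_mod J \<Gamma> {m..<m + 0} 0 0 {1}"
    unfolding spans_mod_def
  proof (intro allI impI)
    fix R p assume "polyfun J R p"
    then obtain c where "p = cst c" using polyfun_empty \<open>J = {}\<close> by metis
    then have "p \<in> cfun.span {1}" by (auto simp: cfun.span_singleton)
    then show "\<exists>b q t. b \<in> cfun.span {1} \<and> polyfun J (R - 0) q \<and>
        psum_ideal J \<Gamma> {m..<m + 0} R t \<and> p = b + 0 * q + t"
      by (intro exI[of _ p] exI[of _ 0]) (auto intro: polyfun.intros psum_ideal.intros)
  qed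
  then show ?case by (intro exI[of _ "{1}"]) auto
next
  case (Suc n)
  note IH_vars = Suc.IH and J = Suc.prems
  show ?case
  proof (induction m)
    \<comment> \<open>The power sum of exponent 0 is the total circulation, a nonzero constant. The
      ideal is then the whole ring and the empty set spans the quotient.\<close>
    case 0
    define s where "s = (\<Sum>j\<in>J. \<Gamma> j)"
    have "s \<noteq> 0" unfolding s_def using J(2) by (intro J(3)) auto
    have "spans_mod J \<Gamma> {0..<0 + Suc n} 0 0 {}"
      unfolding spans_mod_def
    proof (intro allI impI)
      fix R p assume p: "polyfun J R p"
      have "psum_ideal J \<Gamma> {0..<0 + Suc n} R ((cst (1 / s) * p) * psum J \<Gamma> 0)"
        using p by (intro psum_ideal_gen[of _ _ _ R] polyfun_cmult) auto
      moreover have "(cst (1 / s) * p) * psum J \<Gamma> 0 = p"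
        using \<open>s \<noteq> 0\<close> by (auto simp: fun_apply fun_eq_iff psum_def s_def)
      ultimately show "\<exists>b q t. b \<in> cfun.span {} \<and> polyfun J (R - 0) q \<and>
          psum_ideal J \<Gamma> {0..<0 + Suc n} R t \<and> p = b + 0 * q + t"
        by (intro exI[of _ 0] exI[of _ p]) (auto intro: polyfun.intros)
    qed
    then show ?case by (intro exI[of _ "{}"]) (auto intro: exI[of _ 0])
  next
    case (Suc m)
    let ?A = "{Suc m..<Suc m + Suc n}" and ?e = "\<Prod>i\<in>J. coord i"
    let ?D = "\<Prod>l<n. Suc m + l"
    from Suc.IH obtain C where C: "finite C" "card C \<le> (\<Prod>l<Suc n. m + l)"
      "spans_mod J \<Gamma> {m..<m + Suc n} 0 0 C" by auto
    have "\<exists>B. finite B \<and> card B \<le> ?D \<and> spans_mod J \<Gamma> ?A (coord i) 1 B" if i: "i \<in> J" for i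
    proof -
      have "\<exists>B. finite B \<and> card B \<le> ?D \<and> spans_mod (J - {i}) \<Gamma> {Suc m..<Suc m + n} 0 0 B"
        using J i by (intro IH_vars) auto
      then obtain B where B: "finite B" "card B \<le> ?D"
        "spans_mod (J - {i}) \<Gamma> {Suc m..<Suc m + n} 0 0 B" by blast
      have "spans_mod J \<Gamma> ?A (coord i) 1 B"
        unfolding spans_mod_def
      proof (intro allI impI)
        fix R p assume "polyfun J R p"
        then obtain p0 q0 where pq: "polyfun (J - {i}) R p0" "polyfun J (R - 1) q0" "p = p0 + coord i * q0"
          using polyfun_split i by meson
        obtain b q t where b: "b \<in> cfun.span B" "psum_ideal (J - {i}) \<Gamma> {Suc m..<Suc m + n} R t"
          "p0 = b + 0 * q + t"
          using B(3) pq(1) unfolding spans_mod_def by meson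
        obtain q1 s where s: "polyfun J (R - 1) q1" "psum_ideal J \<Gamma> {Suc m..<Suc m + n} R s"
          "t = s + coord i * q1"
          using psum_ideal_remove[OF b(2) i] J by auto
        \<comment> \<open>With one variable fewer, only the first n of the n + 1 exponents in
          \<open>?A\<close> are used.\<close>
        have "psum_ideal J \<Gamma> ?A R s"
          using s(2) by (rule psum_ideal_subset) auto
        then show "\<exists>b q t. b \<in> cfun.span B \<and> polyfun J (R - 1) q \<and>
            psum_ideal J \<Gamma> ?A R t \<and> p = b + coord i * q + t"
          using b s pq
          by (intro exI[of _ b] exI[of _ "q0 + q1"] exI[of _ s])
            (auto simp: algebra_simps intro: polyfun.intros)
      qed
      with B show ?thesis by blast
    qed
    then obtain B where B: "finite B" "card B \<le> Suc n * ?D" "spans_mod J \<Gamma> ?A ?e (Suc n) B"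
      using spans_mod_prod_coord[of J J ?D \<Gamma> ?A] J by auto
    have "spans_mod J \<Gamma> ?A 0 0 (B \<union> (*) ?e ` C)"
      unfolding spans_mod_def
    proof (intro allI impI)
      fix R p assume "polyfun J R p"
      \<comment> \<open>The quotient by the product of all coordinates is reduced further with the
        spanning set C for m; multiplying by that product shifts the exponents from m to m +
        1.\<close>
      then obtain b q t where b: "b \<in> cfun.span B" "polyfun J (R - Suc n) q"
        "psum_ideal J \<Gamma> ?A R t" "p = b + ?e * q + t"
        using B(3) unfolding spans_mod_def by meson
      obtain b' q' t' where c: "b' \<in> cfun.span C" "psum_ideal J \<Gamma> {m..<m + Suc n} (R - Suc n) t'"
        "q = b' + 0 * q' + t'"
        using C(3) b(2) unfolding spans_mod_def by meson
      have bc: "b + ?e * b' \<in> cfun.span (B \<union> (*) ?e ` C)"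
        using b(1) span_mult_image[OF c(1), of ?e] cfun.span_mono[of B "B \<union> (*) ?e ` C"]
          cfun.span_mono[of "(*) ?e ` C" "B \<union> (*) ?e ` C"]
        by (intro cfun.span_add) auto
      show "\<exists>b q t. b \<in> cfun.span (B \<union> (*) ?e ` C) \<and> polyfun J (R - 0) q \<and>
          psum_ideal J \<Gamma> ?A R t \<and> p = b + 0 * q + t"
      proof (cases "Suc n \<le> R")
        case True
        have "psum_ideal J \<Gamma> ?A (R - Suc n + Suc n) (?e * t')"
          using J c(2) by (intro psum_ideal_shift)
        with True have "psum_ideal J \<Gamma> ?A R (t + ?e * t')"
          using b(3) by (intro psum_ideal_add) auto
        then show ?thesis
          using bc b(4) c(3)
          by (intro exI[of _ "b + ?e * b'"] exI[of _ 0] exI[of _ "t + ?e * t'"])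
            (auto simp: algebra_simps intro: polyfun.intros)
      next
        case False
        then have "q = 0" using b(2) by (simp add: polyfun_0_iff)
        then show ?thesis
          using b cfun.span_mono[of B "B \<union> (*) ?e ` C"]
          by (intro exI[of _ b] exI[of _ 0] exI[of _ t]) (auto intro: polyfun.intros)
      qed
    qed
    moreover have "card (B \<union> (*) ?e ` C) \<le> (\<Prod>l<Suc n. Suc m + l)"
    proof -
      \<comment> \<open>Both contributions are multiples of \<open>?D\<close>, and m + (n + 1) is
        exactly the last factor of the product for m + 1.\<close>
      have "(\<Prod>l<Suc n. m + l) = m * ?D"
        by (subst prod.lessThan_Suc_shift) simp
      moreover have "card (B \<union> (*) ?e ` C) \<le> Suc n * ?D + (\<Prod>l<Suc n. m + l)"
        using B(1,2) C(1,2) by (meson add_mono card_Un_le card_image_le le_trans)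
      ultimately show ?thesis by (simp add: algebra_simps)
    qed
    ultimately show ?case
      using B(1) C(1) by (intro exI[of _ "B \<union> (*) ?e ` C"]) auto
  qed
qed

section \<open>From spanning sets to the number of points\<close>

text \<open>As in Lagrange interpolation, every y in T contributes a linear factor in a coordinate
  separating x from y.\<close>

lemma polyfun_interpolation:
  assumes "finite T" "\<And>y. y \<in> T \<Longrightarrow> \<exists>i\<in>J. x i \<noteq> y i"
  shows "\<exists>R p. polyfun J R p \<and> p x = 1 \<and> (\<forall>y\<in>T. p y = 0)"
  using assms
proof (induction T rule: finite_induct)
  case empty
  show ?case
    by (intro exI[of _ "Suc 0"] exI[of _ 1] conjI) (rule polyfun_one, auto simp: fun_apply)
next
  case (insert y T)
  then obtain R p where p: "polyfun J R p" "p x = 1" "\<And>y. y \<in> T \<Longrightarrow> p y = 0"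
    by auto
  obtain i where i: "i \<in> J" "x i \<noteq> y i"
    using insert.prems by blast
  define q where "q = cst (1 / (x i - y i)) * (coord i + cst (- y i))"
  have "polyfun J (Suc 1) q"
    unfolding q_def using i(1) polyfun_coord[of i J] by (intro polyfun_cmult polyfun_add polyfun_cst) auto
  then have "polyfun J (R + 1) (p * q)"
    by (rule polyfun_mult[OF p(1)])
  moreover have "(p * q) x = 1"
    using i(2) p(2) by (simp add: q_def fun_apply)
  moreover have "\<forall>y'\<in>insert y T. (p * q) y' = 0"
    using p(3) by (auto simp: q_def fun_apply)
  ultimately show ?case by blast
qed

text \<open>On S each generator of exponent l may be replaced by a polynomial of degree below l.
  Since the degree bound holds for each summand, the whole sum drops by one degree, even if its
  leading terms cancel.\<close>

lemma psum_ideal_reduce: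
  assumes "psum_ideal J \<Gamma> A R t"
    and "\<And>l. l \<in> A \<Longrightarrow> \<exists>g. polyfun J l g \<and> (\<forall>z\<in>S. psum J \<Gamma> l z = g z)"
  shows "\<exists>p. polyfun J (R - 1) p \<and> (\<forall>z\<in>S. t z = p z)"
  using assms(1)
proof (induction rule: psum_ideal.induct)
  case (psum_ideal_zero R)
  show ?case by (intro exI[of _ 0]) (auto intro: polyfun_zero)
next
  case (psum_ideal_gen l r h R)
  then obtain g where g: "polyfun J l g" "\<And>z. z \<in> S \<Longrightarrow> psum J \<Gamma> l z = g z"
    using assms(2) by blast
  have "polyfun J (R - 1) (h * g)"
  proof (cases l)
    case 0
    then show ?thesis using g(1) by (simp add: polyfun_0_iff polyfun_zero)
  next
    case (Suc d)
    then have "polyfun J (r + d) (h * g)"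
      using psum_ideal_gen.hyps(2) g(1) by (intro polyfun_mult) auto
    then show ?thesis
      by (rule polyfun_mono) (use psum_ideal_gen.hyps(3) Suc in auto)
  qed
  then show ?case
    using g(2) by (intro exI[of _ "h * g"] conjI) (assumption, simp add: fun_apply)
next
  case (psum_ideal_add R t u)
  then obtain p q where "polyfun J (R - 1) p" "\<forall>z\<in>S. t z = p z"
    "polyfun J (R - 1) q" "\<forall>z\<in>S. u z = q z" by blast
  then show ?case by (intro exI[of _ "p + q"] conjI polyfun_add) (simp_all add: fun_apply)
qed

text \<open>Reducing modulo the ideal and then lowering the degree on S can be iterated until
  nothing is left, so every polynomial agrees on S with an element of the span of B. Polynomials
  separate finitely many points of S, hence there are at most \<open>card B\<close> points.\<close>

lemma card_le_prod_if_psum_reduce: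
  fixes \<Gamma> :: "'i \<Rightarrow> complex" and S :: "('i \<Rightarrow> complex) set"
  assumes J: "finite J" "card J = n"
    and \<Gamma>: "\<And>I. I \<noteq> {} \<Longrightarrow> I \<subseteq> J \<Longrightarrow> (\<Sum>j\<in>I. \<Gamma> j) \<noteq> 0"
    and sep: "\<And>x y. x \<in> S \<Longrightarrow> y \<in> S \<Longrightarrow> x \<noteq> y \<Longrightarrow> \<exists>i\<in>J. x i \<noteq> y i"
    and red: "\<And>l. l \<in> {m..<m + n} \<Longrightarrow> \<exists>g. polyfun J l g \<and> (\<forall>z\<in>S. psum J \<Gamma> l z = g z)"
  shows "finite S \<and> card S \<le> (\<Prod>l<n. m + l)"
proof -
  obtain B where B: "finite B" "card B \<le> (\<Prod>l<n. m + l)" "spans_mod J \<Gamma> {m..<m + n} 0 0 B"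
    using spans_mod_psum_ideal[OF J \<Gamma>] by blast
  have span: "\<exists>b \<in> cfun.span B. \<forall>z\<in>S. p z = b z" if "polyfun J R p" for R p
    using that
  proof (induction R arbitrary: p)
    case 0
    then show ?case using cfun.span_zero by (intro bexI[of _ 0]) (auto simp: polyfun_0_iff)
  next
    case (Suc R)
    obtain b q t where b: "b \<in> cfun.span B" "psum_ideal J \<Gamma> {m..<m + n} (Suc R) t" "p = b + 0 * q + t"
      using B(3) Suc.prems unfolding spans_mod_def by meson
    obtain u where u: "polyfun J R u" "\<forall>z\<in>S. t z = u z"
      using psum_ideal_reduce[OF b(2) red] by auto
    obtain b' where "b' \<in> cfun.span B" "\<forall>z\<in>S. u z = b' z"
      using Suc.IH[OF u(1)] by blast
    moreover from this have "b + b' \<in> cfun.span B"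
      using b(1) by (intro cfun.span_add)
    moreover have "p z = b z + t z" for z
      using b(3) by (simp add: fun_apply)
    ultimately show ?case
      using u(2) by (intro bexI[of _ "b + b'"]) (simp add: fun_apply, assumption)
  qed
  have "card T \<le> card B" if T: "T \<subseteq> S" "finite T" for T
  proof -
    \<comment> \<open>Multiplying by the indicator \<chi> of T turns agreement on S into equality of
      functions, so the point indicators \<delta> x lie in a span of at most \<open>card B\<close>
      elements.\<close>
    define \<chi> :: "('i \<Rightarrow> complex) \<Rightarrow> complex" where "\<chi> = (\<lambda>z. if z \<in> T then 1 else 0)"
    define \<delta> :: "('i \<Rightarrow> complex) \<Rightarrow> ('i \<Rightarrow> complex) \<Rightarrow> complex" where "\<delta> x = (\<lambda>z. if z = x then 1 else 0)" for x
    have "\<delta> x \<in> cfun.span ((*) \<chi> ` B)" if x: "x \<in> T" for x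
    proof -
      have "\<exists>i\<in>J. x i \<noteq> y i" if "y \<in> T - {x}" for y
        using sep[of x y] x T(1) that by auto
      then obtain R p where p: "polyfun J R p" "p x = 1" "\<And>y. y \<in> T - {x} \<Longrightarrow> p y = 0"
        using polyfun_interpolation[of "T - {x}" J x] T(2) by auto
      obtain b where b: "b \<in> cfun.span B" "\<And>z. z \<in> S \<Longrightarrow> p z = b z"
        using span[OF p(1)] by blast
      have "\<delta> x = \<chi> * b"
      proof
        fix z
        show "\<delta> x z = (\<chi> * b) z"
          using p(2,3) b(2)[of z] T(1) x by (auto simp: \<delta>_def \<chi>_def fun_apply)
      qed
      with span_mult_image[OF b(1)] show ?thesis by simp
    qed
    moreover have "cfun.independent (\<delta> ` T)"
      unfolding cfun.dependent_def
    proof (safe)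
      fix x assume "\<delta> x \<in> cfun.span (\<delta> ` T - {\<delta> x})"
      \<comment> \<open>Evaluation at x annihilates every other point indicator and hence their
        span.\<close>
      then have "\<delta> x x = 0"
      proof (induction rule: cfun.span_induct_alt)
        case (step c f g)
        then obtain y where "f = \<delta> y" "y \<noteq> x" by auto
        with step show ?case by (simp add: fun_apply \<delta>_def)
      qed (simp add: fun_apply)
      then show False by (simp add: \<delta>_def)
    qed
    ultimately have "card (\<delta> ` T) \<le> card ((*) \<chi> ` B)"
      using cfun.independent_span_bound[of "(*) \<chi> ` B" "\<delta> ` T"] B(1) by auto
    moreover have "card (\<delta> ` T) = card T"
      by (intro card_image inj_onI) (metis \<delta>_def zero_neq_one)
    ultimately show ?thesis
      using card_image_le[OF B(1), of "(*) \<chi>"] by simp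
  qed
  then show ?thesis
    using finite_if_finite_subsets_card_bdd[of S "card B"] B(2) by (meson le_trans)
qed

section \<open>Equilibria\<close>

text \<open>Exchanging j and k flips the sign of the denominator, so averaging both orders produces
  the divided difference of x ^ e, a polynomial of degree e - 1 that is zero for e = 0.\<close>

lemma sum_pairs_divided_difference:
  fixes c x :: "'i \<Rightarrow> 'a::field_char_0"
  assumes "finite I" "inj_on x I"
  shows "(\<Sum>j\<in>I. \<Sum>k\<in>I - {j}. c j * c k * x j ^ e / (x j - x k))
    = 1 / 2 * (\<Sum>j\<in>I. \<Sum>k\<in>I - {j}. c j * c k * (\<Sum>i<e. x k ^ (e - Suc i) * x j ^ i))"
proof -
  let ?f = "\<lambda>j k. c j * c k * x j ^ e / (x j - x k)"
  \<comment> \<open>The diagonal may be added freely: its terms are divisions by zero and have the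
    value 0.\<close>
  have all: "(\<Sum>j\<in>I. \<Sum>k\<in>I - {j}. ?f j k) = (\<Sum>j\<in>I. \<Sum>k\<in>I. ?f j k)"
    using assms(1) by (intro sum.cong sum.mono_neutral_left) auto
  have "(\<Sum>j\<in>I. \<Sum>k\<in>I. ?f j k) = (\<Sum>j\<in>I. \<Sum>k\<in>I. ?f k j)"
    by (rule sum.swap)
  then have "2 * (\<Sum>j\<in>I. \<Sum>k\<in>I. ?f j k) = (\<Sum>j\<in>I. \<Sum>k\<in>I. ?f j k + ?f k j)"
    by (simp add: sum.distrib)
  also have "\<dots> = (\<Sum>j\<in>I. \<Sum>k\<in>I - {j}. ?f j k + ?f k j)"
    using assms(1) by (intro sum.cong sum.mono_neutral_right) auto
  also have "\<dots> = (\<Sum>j\<in>I. \<Sum>k\<in>I - {j}. c j * c k * (\<Sum>i<e. x k ^ (e - Suc i) * x j ^ i))"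
  proof (intro sum.cong refl)
    fix j k assume "j \<in> I" "k \<in> I - {j}"
    then have ne: "x j - x k \<noteq> 0" using assms(2) by (auto simp: inj_on_def)
    have "?f k j = - (c j * c k * x k ^ e / (x j - x k))"
      using ne by (simp add: field_simps)
    then have "?f j k + ?f k j = c j * c k * ((x j ^ e - x k ^ e) / (x j - x k))"
      by (simp add: diff_divide_distrib algebra_simps)
    also have "(x j ^ e - x k ^ e) / (x j - x k) = (\<Sum>i<e. x k ^ (e - Suc i) * x j ^ i)"
      using ne by (subst power_diff_sumr2) simp
    finally show "?f j k + ?f k j = c j * c k * (\<Sum>i<e. x k ^ (e - Suc i) * x j ^ i)" .
  qed
  finally show ?thesis using all by (simp add: nonzero_eq_divide_eq mult.commute)
qed

lemma equilibria_psum_reduce: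
  fixes \<Gamma> :: "nat \<Rightarrow> real"
  assumes "w \<noteq> 0" "degree w \<le> l"
  shows "\<exists>g. polyfun {1..n} l g \<and>
    (\<forall>z\<in>equilibria n \<Gamma> w. psum {1..n} (\<lambda>j. complex_of_real (\<Gamma> j)) l z = g z)"
proof -
  define I where "I = {1..n}"
  define c where "c j = complex_of_real (\<Gamma> j)" for j
  define m where "m = degree w"
  \<comment> \<open>With the weight c j * z j ^ e, the leading term of w contributes the power sum
    of exponent m + e = l.\<close>
  define e where "e = l - m"
  define \<kappa> where "\<kappa> = 2 * complex_of_real pi * \<i>"
  define G :: "(nat \<Rightarrow> complex) \<Rightarrow> complex" where
    "G = (\<Sum>j\<in>I. \<Sum>k\<in>I - {j}. cst (c j * c k) * (\<Sum>i<e. coord k ^ (e - Suc i) * coord j ^ i))"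
  \<comment> \<open>This is the weighted sum of the equations solved for the power sum of exponent
    l. The interaction term G has degree below e, and the lower coefficients of w give power sums of
    degree below l.\<close>
  define g where "g = cst (1 / lead_coeff w) *
    (cst (- 1 / (2 * \<kappa>)) * G + - (\<Sum>i<m. cst (coeff w i) * psum I c (e + i)))"
  have l: "l = m + e" using assms(2) by (simp add: e_def m_def)
  have "polyfun I e G"
    unfolding G_def
  proof (intro polyfun_sum polyfun_cmult)
    fix j k i assume jk: "j \<in> I" "k \<in> I - {j}" "i \<in> {..<e}"
    then have "polyfun I (Suc (e - Suc i) + i) (coord k ^ (e - Suc i) * coord j ^ i)"
      by (intro polyfun_mult polyfun_coord_power) auto
    then show "polyfun I e (coord k ^ (e - Suc i) * coord j ^ i)"
      using jk(3) by simp
  qed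
  then have "polyfun I l G"
    by (rule polyfun_mono) (simp add: l)
  moreover have "polyfun I l (psum I c (e + i))" if "i < m" for i
  proof -
    have "polyfun I (Suc (e + i)) (psum I c (e + i))"
      unfolding psum_def by (intro polyfun_sum polyfun_cmult polyfun_coord_power)
    then show ?thesis by (rule polyfun_mono) (use that l in auto)
  qed
  ultimately have "polyfun I l g"
    unfolding g_def by (intro polyfun_cmult polyfun_add polyfun_uminus polyfun_sum) auto
  moreover have "psum I c l z = g z" if z: "z \<in> equilibria n \<Gamma> w" for z
  proof -
    have \<kappa>: "\<kappa> \<noteq> 0" by (simp add: \<kappa>_def)
    have inj: "inj_on z I" and eq: "\<And>j. j \<in> I \<Longrightarrow> - poly w (z j) = 1 / \<kappa> * (\<Sum>k\<in>I - {j}. c k / (z j - z k))"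
      using z by (auto simp: equilibria_def I_def c_def \<kappa>_def)
    have "- (\<Sum>j\<in>I. c j * z j ^ e * poly w (z j)) = (\<Sum>j\<in>I. c j * z j ^ e * (- poly w (z j)))"
      by (simp add: sum_negf)
    also have "\<dots> = (\<Sum>j\<in>I. c j * z j ^ e * (1 / \<kappa> * (\<Sum>k\<in>I - {j}. c k / (z j - z k))))"
      by (intro sum.cong refl arg_cong2[of _ _ _ _ "(*)"] eq)
    also have "\<dots> = 1 / \<kappa> * (\<Sum>j\<in>I. \<Sum>k\<in>I - {j}. c j * c k * z j ^ e / (z j - z k))"
      by (simp add: sum_distrib_left mult_ac)
    also have "\<dots> = 1 / (2 * \<kappa>) * G z"
      by (subst sum_pairs_divided_difference[OF _ inj])
        (auto simp: I_def G_def fun_apply sum_distrib_left mult.commute[of \<kappa>])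
    finally have 1: "(\<Sum>j\<in>I. c j * z j ^ e * poly w (z j)) = - 1 / (2 * \<kappa>) * G z"
      by (simp add: minus_equation_iff)
    have "(\<Sum>j\<in>I. c j * z j ^ e * poly w (z j)) = (\<Sum>j\<in>I. \<Sum>i\<le>m. coeff w i * (c j * z j ^ (e + i)))"
      by (simp add: poly_altdef m_def sum_distrib_left power_add mult_ac)
    also have "\<dots> = (\<Sum>i\<le>m. coeff w i * psum I c (e + i) z)"
      by (subst sum.swap) (simp add: psum_def fun_apply sum_distrib_left)
    also have "\<dots> = (\<Sum>i<m. coeff w i * psum I c (e + i) z) + lead_coeff w * psum I c l z"
      by (simp add: lessThan_Suc_atMost[symmetric] m_def l add.commute)
    finally have "lead_coeff w * psum I c l z
        = - 1 / (2 * \<kappa>) * G z - (\<Sum>i<m. coeff w i * psum I c (e + i) z)"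
      using 1 by (simp add: algebra_simps)
    then show ?thesis
      using assms(1) by (simp add: g_def fun_apply field_simps)
  qed
  ultimately show ?thesis unfolding I_def c_def by blast
qed

lemma prod_add_eq_fact_div:
  assumes "m \<ge> 1"
  shows "real (\<Prod>l<n. m + l) = fact (m + n - 1) / fact (m - 1)"
proof (induction n)
  case (Suc n)
  have "m + Suc n - 1 = Suc (m + n - 1)" using assms by simp
  then have "fact (m + Suc n - 1) = real (m + n) * fact (m + n - 1)"
    using assms by (metis Suc_pred' add_gr_0 fact_Suc less_eq_Suc_le One_nat_def)
  then show ?case using Suc by simp
qed simp

lemma card_equilibria:
  assumes "admissible n m \<Gamma> w"
  shows "finite (equilibria n \<Gamma> w)"
    and "real (card (equilibria n \<Gamma> w)) \<le> fact (m + n - 1) / fact (m - 1)"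
proof -
  have m: "m \<ge> 1" "degree w = m"
    and \<Gamma>: "\<And>I. I \<noteq> {} \<Longrightarrow> I \<subseteq> {1..n} \<Longrightarrow> (\<Sum>j\<in>I. \<Gamma> j) \<noteq> 0"
    using assms by (auto simp: admissible_def)
  have "finite (equilibria n \<Gamma> w) \<and> card (equilibria n \<Gamma> w) \<le> (\<Prod>l<n. m + l)"
  proof (rule card_le_prod_if_psum_reduce)
    show "(\<Sum>j\<in>I. complex_of_real (\<Gamma> j)) \<noteq> 0" if "I \<noteq> {}" "I \<subseteq> {1..n}" for I
      using \<Gamma>[OF that] by (metis of_real_eq_0_iff of_real_sum)
    show "\<exists>i\<in>{1..n}. x i \<noteq> y i"
      if "x \<in> equilibria n \<Gamma> w" "y \<in> equilibria n \<Gamma> w" "x \<noteq> y" for x y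
      using that unfolding equilibria_def by (metis (lifting) PiE_ext mem_Collect_eq)
    show "\<exists>g. polyfun {1..n} l g \<and>
        (\<forall>z\<in>equilibria n \<Gamma> w. psum {1..n} (\<lambda>j. complex_of_real (\<Gamma> j)) l z = g z)"
      if "l \<in> {m..<m + n}" for l
      using that m by (intro equilibria_psum_reduce) auto
  qed auto
  then show "finite (equilibria n \<Gamma> w)"
    and "real (card (equilibria n \<Gamma> w)) \<le> fact (m + n - 1) / fact (m - 1)"
    unfolding prod_add_eq_fact_div[OF m(1), symmetric] of_nat_le_iff by blast+
qed

section \<open>Relabelling points of equal circulation\<close>

definition fibre_perms :: "('i \<Rightarrow> 'c) \<Rightarrow> 'i set \<Rightarrow> ('i \<Rightarrow> 'i) set" where
  "fibre_perms \<Gamma> I = {\<sigma>. \<sigma> permutes I \<and> (\<forall>j\<in>I. \<Gamma> (\<sigma> j) = \<Gamma> j)}"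

text \<open>One permutation chosen on each fibre of \<Gamma> glues to a permutation \<Phi> \<tau> of
  I. It is injective because equal images have equal circulation and so come from one fibre; the
  choices can be read off from the glued map.\<close>

lemma card_fibre_perms_ge:
  assumes I: "finite I"
  shows "(\<Prod>c\<in>\<Gamma> ` I. fact (card {j \<in> I. \<Gamma> j = c})) \<le> card (fibre_perms \<Gamma> I)"
proof -
  define F where "F c = {j \<in> I. \<Gamma> j = c}" for c
  define P where "P = (\<Pi>\<^sub>E c\<in>\<Gamma> ` I. {p. p permutes F c})"
  define \<Phi> where "\<Phi> \<tau> j = (if j \<in> I then \<tau> (\<Gamma> j) j else j)" for \<tau> :: "'b \<Rightarrow> 'a \<Rightarrow> 'a" and j
  have perm: "\<tau> (\<Gamma> j) permutes F (\<Gamma> j)" if "\<tau> \<in> P" "j \<in> I" for \<tau> j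
    using that by (auto simp: P_def)
  have mem: "\<Phi> \<tau> j \<in> I \<and> \<Gamma> (\<Phi> \<tau> j) = \<Gamma> j" if "\<tau> \<in> P" "j \<in> I" for \<tau> j
    using permutes_in_image[OF perm[OF that], of j] that(2) by (auto simp: F_def \<Phi>_def)
  have "\<Phi> \<tau> \<in> fibre_perms \<Gamma> I" if \<tau>: "\<tau> \<in> P" for \<tau>
  proof -
    have "inj_on (\<Phi> \<tau>) I"
    proof (rule inj_onI)
      fix i j assume ij: "i \<in> I" "j \<in> I" "\<Phi> \<tau> i = \<Phi> \<tau> j"
      then have "\<Gamma> i = \<Gamma> j" using mem[OF \<tau>] by metis
      then show "i = j"
        using ij permutes_inj[OF perm[OF \<tau> ij(2)]] by (auto simp: \<Phi>_def dest: injD)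
    qed
    moreover have "\<Phi> \<tau> ` I \<subseteq> I" using mem[OF \<tau>] by auto
    ultimately have "bij_betw (\<Phi> \<tau>) I I"
      using I by (simp add: bij_betw_def endo_inj_surj)
    then have "\<Phi> \<tau> permutes I"
      by (rule bij_imp_permutes) (simp add: \<Phi>_def)
    then show ?thesis using mem[OF \<tau>] by (simp add: fibre_perms_def)
  qed
  moreover have "inj_on \<Phi> P"
  proof (rule inj_onI)
    fix \<tau> \<tau>' assume P: "\<tau> \<in> P" "\<tau>' \<in> P" and eq: "\<Phi> \<tau> = \<Phi> \<tau>'"
    show "\<tau> = \<tau>'"
    proof (rule PiE_ext[OF P[unfolded P_def]])
      fix c assume c: "c \<in> \<Gamma> ` I"
      then have p: "\<tau> c permutes F c" "\<tau>' c permutes F c"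
        using P by (auto simp: P_def)
      show "\<tau> c = \<tau>' c"
      proof
        fix j
        show "\<tau> c j = \<tau>' c j"
        proof (cases "j \<in> F c")
          case True
          then show ?thesis using fun_cong[OF eq, of j] by (auto simp: \<Phi>_def F_def)
        next
          case False
          then show ?thesis using p by (simp add: permutes_not_in)
        qed
      qed
    qed
  qed
  moreover have "finite (fibre_perms \<Gamma> I)"
    using finite_permutations[OF I] by (rule rev_finite_subset) (auto simp: fibre_perms_def)
  ultimately have "card P \<le> card (fibre_perms \<Gamma> I)"
    by (intro card_inj_on_le[of \<Phi>]) auto
  moreover have "card P = (\<Prod>c\<in>\<Gamma> ` I. fact (card (F c)))"
    unfolding P_def using I by (subst card_PiE) (auto simp: F_def card_permutations intro!: prod.cong)
  ultimately show ?thesis by (simp add: F_def)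
qed

text \<open>Reindexing the sums along \<sigma> leaves the equations and the velocity unchanged, so
  the equivalence holds with a = 1 and b = 0.\<close>

lemma equilibria_relabel:
  assumes \<sigma>: "\<sigma> \<in> fibre_perms \<Gamma> {1..n}" and z: "z \<in> equilibria n \<Gamma> w"
  shows "z \<circ> \<sigma> \<in> equilibria n \<Gamma> w" and "(z, z \<circ> \<sigma>) \<in> config_rel n \<Gamma> w"
proof -
  have p: "\<sigma> permutes {1..n}" and \<Gamma>: "\<And>j. j \<in> {1..n} \<Longrightarrow> \<Gamma> (\<sigma> j) = \<Gamma> j"
    using \<sigma> by (auto simp: fibre_perms_def)
  have bij: "bij_betw \<sigma> {1..n} {1..n}" using p by (rule permutes_imp_bij)
  have ext: "z \<in> {1..n} \<rightarrow>\<^sub>E UNIV" and inj: "inj_on z {1..n}"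
    and eq: "\<And>j. j \<in> {1..n} \<Longrightarrow> - poly w (z j) = 1 / (2 * complex_of_real pi * \<i>) *
          (\<Sum>k\<in>{1..n} - {j}. complex_of_real (\<Gamma> k) / (z j - z k))"
    using z by (auto simp: equilibria_def)
  have "(\<Sum>k\<in>{1..n} - {j}. complex_of_real (\<Gamma> k) / (z (\<sigma> j) - z (\<sigma> k)))
      = (\<Sum>k\<in>{1..n} - {\<sigma> j}. complex_of_real (\<Gamma> k) / (z (\<sigma> j) - z k))" if "j \<in> {1..n}" for j
  proof -
    have "bij_betw \<sigma> ({1..n} - {j}) ({1..n} - {\<sigma> j})"
      using bij that by (intro bij_betw_DiffI) (auto simp: bij_betw_def)
    then have "(\<Sum>k\<in>{1..n} - {\<sigma> j}. complex_of_real (\<Gamma> k) / (z (\<sigma> j) - z k))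
        = (\<Sum>k\<in>{1..n} - {j}. complex_of_real (\<Gamma> (\<sigma> k)) / (z (\<sigma> j) - z (\<sigma> k)))"
      by (rule sum.reindex_bij_betw[symmetric])
    also have "\<dots> = (\<Sum>k\<in>{1..n} - {j}. complex_of_real (\<Gamma> k) / (z (\<sigma> j) - z (\<sigma> k)))"
      using \<Gamma> by (intro sum.cong) auto
    finally show ?thesis ..
  qed
  moreover have "\<sigma> j \<in> {1..n}" if "j \<in> {1..n}" for j
    using permutes_in_image[OF p] that by simp
  moreover have "z \<circ> \<sigma> \<in> {1..n} \<rightarrow>\<^sub>E UNIV"
    using ext p by (auto simp: PiE_def extensional_def permutes_not_in)
  moreover have "inj_on (z \<circ> \<sigma>) {1..n}"
    using bij inj by (intro comp_inj_on) (auto simp: bij_betw_def)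
  ultimately show mem: "z \<circ> \<sigma> \<in> equilibria n \<Gamma> w"
    using eq by (simp add: equilibria_def)
  have "velocity n \<Gamma> w (z \<circ> \<sigma>) \<zeta> = velocity n \<Gamma> w z \<zeta>" for \<zeta>
  proof -
    have "(\<Sum>j\<in>{1..n}. complex_of_real (\<Gamma> j) / (\<zeta> - z j))
        = (\<Sum>j\<in>{1..n}. complex_of_real (\<Gamma> (\<sigma> j)) / (\<zeta> - z (\<sigma> j)))"
      using bij by (rule sum.reindex_bij_betw[symmetric])
    also have "\<dots> = (\<Sum>j\<in>{1..n}. complex_of_real (\<Gamma> j) / (\<zeta> - (z \<circ> \<sigma>) j))"
      using \<Gamma> by (intro sum.cong) auto
    finally show ?thesis by (simp add: velocity_def)
  qed
  moreover have "(z \<circ> \<sigma>) ` {1..n} = z ` {1..n}"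
    using p by (metis image_comp permutes_image)
  ultimately show "(z, z \<circ> \<sigma>) \<in> config_rel n \<Gamma> w"
    unfolding config_rel_def mem_Collect_eq prod.case using z mem
    by (intro conjI exI[of _ "1::complex"] exI[of _ "0::complex"]) simp_all
qed

text \<open>Vortex positions are pairwise distinct, so different relabellings of one solution are
  different solutions, all in the same class.\<close>

lemma card_configuration_ge:
  assumes X: "X \<in> fixed_configurations n \<Gamma> w" "finite X"
  shows "(\<Prod>c\<in>\<Gamma> ` {1..n}. fact (card {j \<in> {1..n}. \<Gamma> j = c})) \<le> card X"
proof -
  obtain z where z: "z \<in> equilibria n \<Gamma> w" "X = config_rel n \<Gamma> w `` {z}"
    using X(1) by (auto simp: fixed_configurations_def elim: quotientE)
  have inj: "inj_on z {1..n}" using z(1) by (simp add: equilibria_def)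
  have "inj_on (\<lambda>\<sigma>. z \<circ> \<sigma>) (fibre_perms \<Gamma> {1..n})"
  proof (intro inj_onI ext)
    fix \<sigma> \<tau> j assume s: "\<sigma> \<in> fibre_perms \<Gamma> {1..n}" "\<tau> \<in> fibre_perms \<Gamma> {1..n}" "z \<circ> \<sigma> = z \<circ> \<tau>"
    then have p: "\<sigma> permutes {1..n}" "\<tau> permutes {1..n}" by (auto simp: fibre_perms_def)
    show "\<sigma> j = \<tau> j"
    proof (cases "j \<in> {1..n}")
      case True
      then show ?thesis
        using fun_cong[OF s(3), of j] inj permutes_in_image[OF p(1), of j] permutes_in_image[OF p(2), of j]
        by (auto dest: inj_onD)
    qed (use p in \<open>simp add: permutes_not_in\<close>)
  qed
  then have "card (fibre_perms \<Gamma> {1..n}) \<le> card X"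
    using equilibria_relabel(2)[OF _ z(1)] z(2) X(2) by (intro card_inj_on_le) auto
  then show ?thesis using card_fibre_perms_ge[of "{1..n}" \<Gamma>] by simp
qed

section \<open>Counting configurations\<close>

lemma card_quotient_mult_le:
  assumes "equiv A r" "finite A" "\<And>X. X \<in> A // r \<Longrightarrow> k \<le> card X"
  shows "card (A // r) * k \<le> card A"
proof -
  have sub: "X \<subseteq> A" if "X \<in> A // r" for X
    using Union_quotient[OF assms(1)] that by blast
  have "card (A // r) * k \<le> (\<Sum>X\<in>A // r. card X)"
    using sum_mono[of "A // r" "\<lambda>_. k" card] assms(3) by simp
  also have "\<dots> = card (\<Union> (A // r))"
    using quotient_disj[OF assms(1)] finite_subset[OF sub assms(2)]
    by (intro card_Union_disjoint[symmetric]) (auto simp: pairwise_def disjnt_def)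
  finally show ?thesis by (simp add: Union_quotient[OF assms(1)])
qed

lemma fixed_configurations_bound:
  assumes "admissible n m \<Gamma> w"
  shows "finite (fixed_configurations n \<Gamma> w)"
    and "real (card (fixed_configurations n \<Gamma> w)) \<le> config_bound n m \<Gamma>"
proof -
  let ?E = "equilibria n \<Gamma> w" and ?r = "config_rel n \<Gamma> w"
  define k :: nat where "k = (\<Prod>c\<in>\<Gamma> ` {1..n}. fact (card {j \<in> {1..n}. \<Gamma> j = c}))"
  note E = card_equilibria[OF assms]
  have sub: "X \<subseteq> ?E" if "X \<in> ?E // ?r" for X
    using Union_quotient[OF equiv_config_rel] that by blast
  then have "?E // ?r \<subseteq> Pow ?E" by blast
  then show "finite (fixed_configurations n \<Gamma> w)"
    unfolding fixed_configurations_def using E(1) by (meson finite_Pow_iff finite_subset)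
  have "card (?E // ?r) * k \<le> card ?E"
  proof (rule card_quotient_mult_le[OF equiv_config_rel E(1)])
    fix X assume "X \<in> ?E // ?r"
    with sub E(1) show "k \<le> card X"
      unfolding k_def by (intro card_configuration_ge) (auto simp: fixed_configurations_def intro: finite_subset)
  qed
  then have "real (card (?E // ?r)) * real k \<le> fact (m + n - 1) / fact (m - 1)"
    using E(2) by (metis of_nat_le_iff of_nat_mult order_trans)
  moreover have "real k > 0" by (simp add: k_def prod_pos)
  ultimately have "real (card (?E // ?r)) \<le> fact (m + n - 1) / fact (m - 1) / real k"
    by (simp only: pos_le_divide_eq)
  then show "real (card (fixed_configurations n \<Gamma> w)) \<le> config_bound n m \<Gamma>"
    by (simp add: fixed_configurations_def config_bound_def k_def)
qed

section \<open>Sharpness of the bound\<close>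

text \<open>Up to exchanging the two vortices the only equilibrium is \<open>\<plusminus> 1 / sqrt 2\<close>; \<open>w\<close> is scaled so that \<open>- 2 * pi * \<i> * w \<zeta> = \<zeta>\<close>.\<close>

lemma fixed_configurations_bound_attained:
  defines "w \<equiv> [:0, - 1 / (2 * complex_of_real pi * \<i>):]"
  shows "admissible 2 1 (\<lambda>_. 1) w"
    and "real (card (fixed_configurations 2 (\<lambda>_. 1) w)) = config_bound 2 1 (\<lambda>_. 1)"
proof -
  let ?\<Gamma> = "\<lambda>_::nat. 1 :: real"
  have I: "{1..2} = {1, 2 :: nat}" by auto
  show adm: "admissible 2 1 ?\<Gamma> w"
    unfolding admissible_def
  proof (intro conjI allI impI)
    show "(\<Sum>j\<in>I. ?\<Gamma> j) \<noteq> 0" if "I \<noteq> {} \<and> I \<subseteq> {1..2}" for I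
      using that by (auto dest: finite_subset)
    have "{1..<2} = {1::nat}" "{1..<1} = ({}::nat set)" by auto
    then show "(\<Sum>j\<in>{1..2}. \<Sum>i\<in>{1..<j}. ?\<Gamma> i * ?\<Gamma> j) \<noteq> 0"
      unfolding I by simp
  qed (auto simp: w_def)
  \<comment> \<open>For positions a and - a both equations reduce to a = 1 / (2 * a).\<close>
  define a where "a = complex_of_real (1 / sqrt 2)"
  have a: "a * a = 1 / 2"
    unfolding a_def by (metis of_real_1 of_real_divide of_real_mult of_real_numeral
        real_sqrt_mult_self times_divide_times_eq mult_1 abs_numeral)
  then have "a \<noteq> 0" by auto
  define z where "z = (\<lambda>j\<in>{1..2::nat}. if j = 1 then a else - a)"
  have z: "z 1 = a" "z 2 = - a" by (auto simp: z_def)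
  have h: "1 / (a + a) = a"
    using a \<open>a \<noteq> 0\<close> by (simp add: field_simps)
  have "{1, 2} - {1} = {2::nat}" "{1, 2} - {2} = {1::nat}" by auto
  moreover have "z \<in> {1, 2} \<rightarrow>\<^sub>E UNIV" unfolding z_def I[symmetric] by simp
  moreover have "1 / (- a - a) = - a"
    using h by (metis minus_add_distrib diff_conv_add_uminus minus_divide_right)
  ultimately have "z \<in> equilibria 2 ?\<Gamma> w"
    unfolding equilibria_def I using z h \<open>a \<noteq> 0\<close> by (simp add: w_def del: One_nat_def)
  \<comment> \<open>The bound is 2! / (0! * 2!) = 1 here, so the existence of one configuration
    already gives equality.\<close>
  then have "fixed_configurations 2 ?\<Gamma> w \<noteq> {}"
    by (auto simp: fixed_configurations_def quotient_is_empty)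
  then have "card (fixed_configurations 2 ?\<Gamma> w) \<noteq> 0"
    using fixed_configurations_bound(1)[OF adm] by simp
  moreover have "{j. Suc 0 \<le> j \<and> j \<le> 2} = {1, 2}" by auto
  then have "config_bound 2 1 ?\<Gamma> = 1"
    by (simp add: config_bound_def image_constant_conv fact_numeral)
  ultimately show "real (card (fixed_configurations 2 ?\<Gamma> w)) = config_bound 2 1 ?\<Gamma>"
    using fixed_configurations_bound(2)[OF adm] by simp
qed

theorem theorem7:
  shows "(\<forall>(n::nat) (m::nat) (\<Gamma>::nat \<Rightarrow> real) (w::complex poly).
            admissible n m \<Gamma> w \<longrightarrow>
              finite (fixed_configurations n \<Gamma> w) \<and>
              real (card (fixed_configurations n \<Gamma> w)) \<le> config_bound n m \<Gamma>)
       \<and> (\<exists>(n::nat) (m::nat) (\<Gamma>::nat \<Rightarrow> real) (w::complex poly).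
            admissible n m \<Gamma> w \<and>
              finite (fixed_configurations n \<Gamma> w) \<and>
              real (card (fixed_configurations n \<Gamma> w)) = config_bound n m \<Gamma>)"
proof (rule conjI)
  show "\<exists>n m \<Gamma> w. admissible n m \<Gamma> w \<and> finite (fixed_configurations n \<Gamma> w) \<and>
      real (card (fixed_configurations n \<Gamma> w)) = config_bound n m \<Gamma>"
    using fixed_configurations_bound(1)[OF fixed_configurations_bound_attained(1)]
      fixed_configurations_bound_attained
    by (intro exI conjI)
qed (use fixed_configurations_bound in auto)

end
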